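(* Let $m\ge3$ be odd, $q=2^i$ with $\gcd(i,m)=1$, and $a\in\mathbb{F}_{2^m}^*$. Define $H_a:\mathbb{F}_{2^m}^3\to\mathbb{F}_{2^m}^3$ by \[H_a(x,y,z)=\bigl(x^{q+1}+axy^q+yz^q,\; xy^q+z^{q+1},\; x^qz+y^{q+1}+ay^qz\bigr).\] Then $H_a$ is APN if and only if $P_a'(T)=T^{q^2+q+1}+aT^{q^2+q}+1$ has no roots in $\mathbb{F}_{2^m}$.
   Context: A function $F:\mathbb{F}_{2^m}^n\to\mathbb{F}_{2^m}^n$ is APN if for every nonzero $\mathbf u$ and every $\mathbf b$ in $\mathbb{F}_{2^m}^n$, the equation $F(\mathbf x+\mathbf u)+F(\mathbf x)=\mathbf b$ has at most two solutions $\mathbf x\in\mathbb{F}_{2^m}^n$. *)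

theory Defs
  imports "HOL-Analysis.Analysis" "HOL-Computational_Algebra.Polynomial"
begin

(* The field F_{2^m} is a type 'a of class {field, finite} with CARD('a) = 2 ^ m, and its
   n-dimensional coordinate space is the vector type 'a ^ 'n. Finiteness of 'a matters
   here: card of an infinite set would be 0. *)
definition APN :: "('a::{field,finite} ^ 'n \<Rightarrow> 'a ^ 'n) \<Rightarrow> bool" where
  "APN F \<longleftrightarrow> (\<forall>u b. u \<noteq> 0 \<longrightarrow> card {x. F (x + u) + F x = b} \<le> 2)"

definition H :: "nat \<Rightarrow> 'a \<Rightarrow> 'a ^ 3 \<Rightarrow> 'a::field ^ 3" where
  "H q a v = (let x = v $ 1; y = v $ 2; z = v $ 3 in
     vector [x ^ (q + 1) + a * x * y ^ q + y * z ^ q,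
             x * y ^ q + z ^ (q + 1),
             x ^ q * z + y ^ (q + 1) + a * y ^ q * z])"

definition P' :: "nat \<Rightarrow> 'a \<Rightarrow> 'a::field poly" where
  "P' q a = monom 1 (q\<^sup>2 + q + 1) + monom a (q\<^sup>2 + q) + 1"

end

theory Submission
  imports Defs "HOL-Number_Theory.Residues"
begin

text \<open>
  Write \<open>\<sigma> x = x ^ q\<close>. Up to the order of coordinates, \<open>H u = u \<times> \<phi> u\<close> (cross product), where
  \<open>\<phi> (x, y, z) = (\<sigma> z, \<sigma> x + a * \<sigma> y, \<sigma> y)\<close> is semilinear. As \<open>H\<close> is quadratic, it fails to be
  APN iff \<open>u \<times> \<phi> v = v \<times> \<phi> u\<close> for some \<open>u \<noteq> 0\<close> and \<open>v \<notin> {0, u}\<close>. If \<open>u\<close> and \<open>v\<close> are dependent,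
  this says that \<open>u\<close> spans a \<open>\<phi>\<close>-invariant line; if not, their span is a \<open>\<phi>\<close>-invariant plane.
  Since \<open>\<lambda> \<mapsto> \<sigma> \<lambda> / \<lambda>\<close> permutes the nonzero elements, an invariant line contains a nonzero fixed
  vector, and an invariant plane is the kernel of a functional \<open>f\<close> with \<open>f \<circ> \<phi> = \<sigma> \<circ> f\<close>. The latter
  prevents \<open>\<phi> + 1\<close> from being surjective, hence from being injective, so again \<open>\<phi>\<close> has a nonzero
  fixed vector \<open>(x, y, z)\<close>. These correspond to the roots \<open>t = y / \<sigma> y\<close> of \<open>P'\<close>.
\<close>

section \<open>Parallel vectors and Frobenius maps with fixed field F_2\<close>

lemma parallel_coords:
  fixes x y z p1 p2 p3 :: "'a::field"
  assumes "(x, y, z) \<noteq> (0, 0, 0)" "x * p2 = y * p1" "x * p3 = z * p1" "y * p3 = z * p2"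
  obtains \<mu> where "p1 = \<mu> * x" "p2 = \<mu> * y" "p3 = \<mu> * z"
proof -
  consider "x \<noteq> 0" | "x = 0" "y \<noteq> 0" | "x = 0" "y = 0" "z \<noteq> 0" using assms(1) by auto
  then show ?thesis
  proof cases
    case 1
    show ?thesis by (rule that[of "p1 / x"]) (use 1 assms in \<open>auto simp: field_simps\<close>)
  next
    case 2
    show ?thesis by (rule that[of "p2 / y"]) (use 2 assms in \<open>auto simp: field_simps\<close>)
  next
    case 3
    show ?thesis by (rule that[of "p3 / z"]) (use 3 assms in \<open>auto simp: field_simps\<close>)
  qed
qed

text \<open>Abstracts \<open>x ^ 2 ^ i\<close> on F_(2^m); coprimality of \<open>i\<close> and
  \<open>m\<close> enters through \<open>\<sigma>_fixed\<close>.\<close>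

locale char2_frobenius =
  fixes \<sigma> :: "'a::{field,finite} \<Rightarrow> 'a"
  assumes char2: "x + x = 0"
    and \<sigma>_add: "\<sigma> (x + y) = \<sigma> x + \<sigma> y"
    and \<sigma>_mult: "\<sigma> (x * y) = \<sigma> x * \<sigma> y"
    and \<sigma>_one: "\<sigma> 1 = 1"
    and \<sigma>_fixed: "\<sigma> x = x \<Longrightarrow> x = 0 \<or> x = 1"
begin

lemma add_eq_0: "x + y = 0 \<longleftrightarrow> x = (y::'a)"
  by (metis char2 add_right_cancel)

lemma minus_eq_add: "x - y = x + (y::'a)"
  by (metis add_eq_0 add_diff_cancel_left' diff_conv_add_uminus add.right_inverse)

lemma \<sigma>_zero: "\<sigma> 0 = 0"
  using \<sigma>_add[of 0 0] unfolding char2 .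

lemma \<sigma>_diff: "\<sigma> (x - y) = \<sigma> x - \<sigma> y"
  unfolding minus_eq_add by (rule \<sigma>_add)

lemma \<sigma>_eq_0: "\<sigma> x = 0 \<longleftrightarrow> x = 0"
proof
  assume "\<sigma> x = 0"
  show "x = 0"
  proof (rule ccontr)
    assume "x \<noteq> 0"
    then have "\<sigma> (x * inverse x) = 1" by (simp add: \<sigma>_one)
    then show False using \<open>\<sigma> x = 0\<close> by (simp add: \<sigma>_mult)
  qed
qed (simp add: \<sigma>_zero)

lemma \<sigma>_divide: "\<sigma> (x / y) = \<sigma> x / \<sigma> y"
proof (cases "y = 0")
  case False
  have "\<sigma> (x / y) * \<sigma> y = \<sigma> (x / y * y)" by (rule \<sigma>_mult[symmetric])
  also have "\<dots> = \<sigma> x" using False by simp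
  finally show ?thesis using False by (simp add: \<sigma>_eq_0 eq_divide_eq)
qed (simp add: \<sigma>_zero)

text \<open>Equal values of \<open>\<sigma> t / t\<close> at \<open>s\<close> and \<open>t\<close>
  make \<open>s / t\<close> a nonzero fixed point, hence 1. Finiteness turns this injectivity into
  surjectivity.\<close>

lemma \<sigma>_scaling:
  assumes "\<mu> \<noteq> 0"
  obtains l where "l \<noteq> 0" "\<sigma> l = \<mu> * l"
proof -
  let ?g = "\<lambda>t. \<sigma> t / t"
  have "inj_on ?g (UNIV - {0})"
  proof (rule inj_onI)
    fix s t assume "s \<in> UNIV - {0}" "t \<in> UNIV - {0}" and eq: "?g s = ?g t"
    then have st: "s \<noteq> 0" "t \<noteq> 0" by simp_all
    have "\<sigma> s * t = \<sigma> t * s" using eq st by (simp add: frac_eq_eq)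
    then have "\<sigma> (s / t) = s / t"
      unfolding \<sigma>_divide using st by (simp add: frac_eq_eq \<sigma>_eq_0 mult.commute)
    from \<sigma>_fixed[OF this] st show "s = t" by simp
  qed
  moreover have "?g ` (UNIV - {0}) \<subseteq> UNIV - {0}" by (auto simp: \<sigma>_eq_0)
  ultimately have "?g ` (UNIV - {0}) = UNIV - {0}" by (intro endo_inj_surj) auto
  then have "\<mu> \<in> ?g ` (UNIV - {0})" using assms by simp
  then obtain t where "\<mu> = ?g t" "t \<noteq> 0" by blast
  then show ?thesis using that[of t] by simp
qed

section \<open>Fixed vectors of \<open>\<phi>\<close> from invariant lines and planes\<close>

definition fixed_vector :: "'a \<Rightarrow> 'a \<Rightarrow> 'a \<Rightarrow> 'a \<Rightarrow> bool" where
  "fixed_vector a x y z \<longleftrightarrow>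
     (x, y, z) \<noteq> (0, 0, 0) \<and> \<sigma> z = x \<and> \<sigma> x + a * \<sigma> y = y \<and> \<sigma> y = z"

text \<open>Scaling an eigenvector by \<open>l\<close> multiplies its eigenvalue by
  \<open>\<sigma> l / l\<close>, which can be chosen as \<open>inverse \<mu>\<close>.\<close>

lemma eigenvector_imp_fixed_vector:
  assumes "(x, y, z) \<noteq> (0, 0, 0)"
    and eqs: "\<sigma> z = \<mu> * x" "\<sigma> x + a * \<sigma> y = \<mu> * y" "\<sigma> y = \<mu> * z"
  shows "\<exists>x y z. fixed_vector a x y z"
proof -
  have "\<mu> \<noteq> 0"
  proof
    assume "\<mu> = 0"
    then have "z = 0" "y = 0" using eqs(1,3) by (simp_all add: \<sigma>_eq_0)
    moreover from this have "x = 0" using eqs(2) \<open>\<mu> = 0\<close> by (simp add: \<sigma>_eq_0 \<sigma>_zero)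
    ultimately show False using assms(1) by simp
  qed
  then obtain l where l: "l \<noteq> 0" "\<sigma> l = inverse \<mu> * l" using \<sigma>_scaling[of "inverse \<mu>"] by auto
  have "\<sigma> (l * x) + a * \<sigma> (l * y) = inverse \<mu> * l * (\<sigma> x + a * \<sigma> y)"
    by (simp add: \<sigma>_mult l(2) algebra_simps)
  also have "\<dots> = l * y" using \<open>\<mu> \<noteq> 0\<close> by (simp add: eqs(2))
  finally have "\<sigma> (l * x) + a * \<sigma> (l * y) = l * y" .
  moreover have "\<sigma> (l * z) = l * x" "\<sigma> (l * y) = l * z"
    using \<open>\<mu> \<noteq> 0\<close> by (simp_all add: \<sigma>_mult l(2) eqs(1,3))
  moreover have "(l * x, l * y, l * z) \<noteq> (0, 0, 0)" using assms(1) l(1) by simp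
  ultimately show ?thesis unfolding fixed_vector_def by blast
qed

lemma cross_eq_0_imp_fixed_vector:
  assumes "(x, y, z) \<noteq> (0, 0, 0)"
    and "x * (\<sigma> x + a * \<sigma> y) = y * \<sigma> z" "x * \<sigma> y = z * \<sigma> z" "y * \<sigma> y = z * (\<sigma> x + a * \<sigma> y)"
  shows "\<exists>x y z. fixed_vector a x y z"
proof -
  obtain \<mu> where "\<sigma> z = \<mu> * x" "\<sigma> x + a * \<sigma> y = \<mu> * y" "\<sigma> y = \<mu> * z"
    by (rule parallel_coords[OF assms])
  then show ?thesis by (rule eigenvector_imp_fixed_vector[OF assms(1)])
qed

lemma \<sigma>_add_id_not_surj: "\<not> surj (\<lambda>t. \<sigma> t + t)"
proof
  assume "surj (\<lambda>t. \<sigma> t + t)"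
  then have "inj (\<lambda>t. \<sigma> t + t)" by (rule finite_UNIV_surj_inj[OF finite])
  from injD[OF this, of 0 1] show False by (simp add: \<sigma>_zero \<sigma>_one char2)
qed

text \<open>For f = A x + B y + C z the equations say f o \<open>\<phi>\<close> =
  \<open>\<sigma>\<close> o f, so f o (\<open>\<phi>\<close> + 1) = (\<open>\<sigma>\<close> + 1) o
  f. An injective \<open>\<phi>\<close> + 1 would be onto, and f is onto, so \<open>\<sigma>\<close>
  + 1 would be onto, although it sends 0 and 1 to the same value.\<close>

lemma fixed_functional_imp_fixed_vector:
  assumes "(A, B, C) \<noteq> (0, 0, 0)"
    and eqs: "\<sigma> A = B" "\<sigma> B = a * B + C" "\<sigma> C = A"
  shows "\<exists>x y z. fixed_vector a x y z"
proof (rule ccontr)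
  assume none: "\<nexists>x y z. fixed_vector a x y z"
  have "C \<noteq> 0"
  proof
    assume "C = 0"
    then have "A = 0" using eqs(3) by (simp add: \<sigma>_zero)
    then have "B = 0" using eqs(1) by (simp add: \<sigma>_zero)
    then show False using assms(1) \<open>A = 0\<close> \<open>C = 0\<close> by simp
  qed
  let ?g = "\<lambda>(x, y, z). (\<sigma> z + x, \<sigma> x + a * \<sigma> y + y, \<sigma> y + z)"
  have "inj ?g"
  proof (rule injI)
    fix p p' assume "?g p = ?g p'"
    obtain x y z x' y' z' where p: "p = (x, y, z)" "p' = (x', y', z')" using prod_cases3 by metis
    have *: "\<sigma> z + x = \<sigma> z' + x'" "\<sigma> x + a * \<sigma> y + y = \<sigma> x' + a * \<sigma> y' + y'"
      "\<sigma> y + z = \<sigma> y' + z'"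
      using \<open>?g p = ?g p'\<close> by (simp_all add: p)
    \<comment> \<open>By additivity, the difference of two points with equal image is killed by
      \<open>\<phi>\<close> + 1, so it is fixed by \<open>\<phi>\<close>.\<close>
    let ?x = "x - x'" and ?y = "y - y'" and ?z = "z - z'"
    have "\<sigma> ?z + ?x = (\<sigma> z + x) - (\<sigma> z' + x')"
      "\<sigma> ?x + a * \<sigma> ?y + ?y = (\<sigma> x + a * \<sigma> y + y) - (\<sigma> x' + a * \<sigma> y' + y')"
      "\<sigma> ?y + ?z = (\<sigma> y + z) - (\<sigma> y' + z')"
      by (simp_all add: \<sigma>_diff algebra_simps)
    then have "\<sigma> ?z + ?x = 0" "\<sigma> ?x + a * \<sigma> ?y + ?y = 0" "\<sigma> ?y + ?z = 0"
      unfolding * by simp_all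
    then have "\<sigma> ?z = ?x" "\<sigma> ?x + a * \<sigma> ?y = ?y" "\<sigma> ?y = ?z"
      unfolding add_eq_0 by auto
    with none have "(?x, ?y, ?z) = (0, 0, 0)" unfolding fixed_vector_def by blast
    then show "p = p'" by (simp add: p)
  qed
  then have surj: "surj ?g" by (rule finite_UNIV_inj_surj[OF finite])
  have "\<exists>t. e = \<sigma> t + t" for e
  proof -
    \<comment> \<open>The functional takes the value \<open>e\<close> at
      \<open>(0, 0, e / C)\<close>; this is why \<open>C \<noteq> 0\<close> matters.\<close>
    obtain p where p: "(0, 0, e / C) = ?g p" using surj by (rule surjE)
    obtain x y z where "p = (x, y, z)" by (rule prod_cases3)
    with p have *: "\<sigma> z + x = 0" "\<sigma> x + a * \<sigma> y + y = 0" "\<sigma> y + z = e / C"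
      by simp_all
    have "\<sigma> (A * x + B * y + C * z) + (A * x + B * y + C * z)
        = A * (\<sigma> z + x) + B * (\<sigma> x + a * \<sigma> y + y) + C * (\<sigma> y + z)"
      by (simp add: \<sigma>_add \<sigma>_mult eqs algebra_simps)
    also have "\<dots> = e" unfolding * using \<open>C \<noteq> 0\<close> by simp
    finally show ?thesis by metis
  qed
  then have "surj (\<lambda>t. \<sigma> t + t)" unfolding surj_def by blast
  then show False using \<sigma>_add_id_not_surj by contradiction
qed

text \<open>\<open>(A, B, C)\<close> is the normal \<open>u \<times> v\<close> of the invariant plane, hence an eigenvector of the
  adjoint of \<open>\<phi>\<close>.\<close>

lemma invariant_plane_imp_fixed_vector:
  fixes x y z X Y Z a :: 'a
  defines "A \<equiv> y * Z - z * Y" and "B \<equiv> z * X - x * Z" and "C \<equiv> x * Y - y * X"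
  assumes n: "(A, B, C) \<noteq> (0, 0, 0)"
    and c1: "x * (\<sigma> X + a * \<sigma> Y) - y * \<sigma> Z = X * (\<sigma> x + a * \<sigma> y) - Y * \<sigma> z"
    and c2: "x * \<sigma> Y - z * \<sigma> Z = X * \<sigma> y - Z * \<sigma> z"
    and c3: "y * \<sigma> Y - z * (\<sigma> X + a * \<sigma> Y) = Y * \<sigma> y - Z * (\<sigma> x + a * \<sigma> y)"
  shows "\<exists>x y z. fixed_vector a x y z"
proof -
  \<comment> \<open>Write u, v for the two vectors and n = u x v. Then \<open>B\<close>,
    \<open>?K\<close>, \<open>A\<close> are the coefficients of \<open>\<sigma> x\<close>,
    \<open>\<sigma> y\<close>, \<open>\<sigma> z\<close> in n . \<open>\<phi>\<close> u. This triple
    product is u . (v x \<open>\<phi>\<close> u) = u . (u x \<open>\<phi>\<close> v) = 0, and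
    similarly for v.\<close>
  let ?K = "a * B + C"
  have "B * \<sigma> x + ?K * \<sigma> y + A * \<sigma> z
      = x * (Y * \<sigma> y - Z * (\<sigma> x + a * \<sigma> y)) - y * (X * \<sigma> y - Z * \<sigma> z)
        + z * (X * (\<sigma> x + a * \<sigma> y) - Y * \<sigma> z)"
    by (simp add: A_def B_def C_def algebra_simps)
  also have "\<dots> = 0" unfolding c1[symmetric] c2[symmetric] c3[symmetric] by (simp add: algebra_simps)
  finally have u: "B * \<sigma> x + ?K * \<sigma> y + A * \<sigma> z = 0" .
  have "B * \<sigma> X + ?K * \<sigma> Y + A * \<sigma> Z
      = - (X * (y * \<sigma> Y - z * (\<sigma> X + a * \<sigma> Y)) - Y * (x * \<sigma> Y - z * \<sigma> Z)
        + Z * (x * (\<sigma> X + a * \<sigma> Y) - y * \<sigma> Z))"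
    by (simp add: A_def B_def C_def algebra_simps)
  also have "\<dots> = 0" unfolding c1 c2 c3 by (simp add: algebra_simps)
  finally have v: "B * \<sigma> X + ?K * \<sigma> Y + A * \<sigma> Z = 0" .
  have \<sigma>n: "\<sigma> A = \<sigma> y * \<sigma> Z - \<sigma> z * \<sigma> Y" "\<sigma> B = \<sigma> z * \<sigma> X - \<sigma> x * \<sigma> Z"
    "\<sigma> C = \<sigma> x * \<sigma> Y - \<sigma> y * \<sigma> X"
    by (simp_all add: A_def B_def C_def \<sigma>_diff \<sigma>_mult)
  let ?U = "B * \<sigma> x + ?K * \<sigma> y + A * \<sigma> z" and ?V = "B * \<sigma> X + ?K * \<sigma> Y + A * \<sigma> Z"
  \<comment> \<open>The identity (p x r) x w = (p . w) r - (r . w) p, with p, r the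
    \<open>\<sigma>\<close>-images of u, v and w = \<open>(B, ?K, A)\<close>, shows that w is
    parallel to \<open>(\<sigma> A, \<sigma> B, \<sigma> C)\<close>.\<close>
  have "\<sigma> A * ?K - \<sigma> B * B = \<sigma> Z * ?U - \<sigma> z * ?V"
    "\<sigma> A * A - \<sigma> C * B = \<sigma> y * ?V - \<sigma> Y * ?U"
    "\<sigma> B * A - \<sigma> C * ?K = \<sigma> X * ?U - \<sigma> x * ?V"
    unfolding \<sigma>n by (simp_all add: algebra_simps)
  then have par: "\<sigma> A * ?K = \<sigma> B * B" "\<sigma> A * A = \<sigma> C * B" "\<sigma> B * A = \<sigma> C * ?K"
    unfolding u v by simp_all
  have "(\<sigma> A, \<sigma> B, \<sigma> C) \<noteq> (0, 0, 0)" using n by (simp add: \<sigma>_eq_0)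
  then obtain \<mu> where \<mu>: "B = \<mu> * \<sigma> A" "?K = \<mu> * \<sigma> B" "A = \<mu> * \<sigma> C"
    by (rule parallel_coords[OF _ par])
  have "\<mu> \<noteq> 0"
  proof
    assume "\<mu> = 0"
    then have "B = 0" "A = 0" using \<mu>(1,3) by simp_all
    moreover from this have "C = 0" using \<mu>(2) \<open>\<mu> = 0\<close> by simp
    ultimately show False using n by simp
  qed
  \<comment> \<open>Scaling the normal by \<open>l\<close> absorbs \<open>\<mu>\<close> and makes
    the functional commute exactly.\<close>
  then obtain l where l: "l \<noteq> 0" "\<sigma> l = \<mu> * l" using \<sigma>_scaling by blast
  show ?thesis
  proof (rule fixed_functional_imp_fixed_vector)
    show "(l * A, l * B, l * C) \<noteq> (0, 0, 0)" using n l(1) by simp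
    have scale: "\<sigma> (l * t) = l * (\<mu> * \<sigma> t)" for t by (simp add: \<sigma>_mult l(2))
    show "\<sigma> (l * A) = l * B" "\<sigma> (l * C) = l * A" "\<sigma> (l * B) = a * (l * B) + l * C"
      unfolding scale \<mu>[symmetric] by (simp_all add: algebra_simps)
  qed
qed

text \<open>Eliminating \<open>x\<close> and \<open>z\<close> leaves
  \<open>\<sigma> (\<sigma> (\<sigma> y)) + a * \<sigma> y = y\<close>. For
  \<open>t = y / \<sigma> y\<close> the products telescope, and dividing by
  \<open>\<sigma> (\<sigma> (\<sigma> y))\<close> gives the equation in \<open>t\<close>.
  Conversely, \<open>\<sigma>_scaling\<close> writes every nonzero \<open>t\<close> in this
  form.\<close>

lemma fixed_vector_iff_root:
  "(\<exists>x y z. fixed_vector a x y z) \<longleftrightarrow>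
   (\<exists>t. \<sigma> (\<sigma> t) * \<sigma> t * t + a * (\<sigma> (\<sigma> t) * \<sigma> t) + 1 = 0)"
proof safe
  fix x y z assume "fixed_vector a x y z"
  then have y: "y \<noteq> 0" "\<sigma> (\<sigma> (\<sigma> y)) + a * \<sigma> y = y"
    by (auto simp: fixed_vector_def \<sigma>_zero)
  have "\<sigma> (\<sigma> (y / \<sigma> y)) * \<sigma> (y / \<sigma> y) * (y / \<sigma> y) + a * (\<sigma> (\<sigma> (y / \<sigma> y)) * \<sigma> (y / \<sigma> y)) + 1
      = (y + (\<sigma> (\<sigma> (\<sigma> y)) + a * \<sigma> y)) / \<sigma> (\<sigma> (\<sigma> y))"
    using y(1) by (simp add: \<sigma>_divide \<sigma>_eq_0 field_simps)
  also have "\<dots> = 0" by (simp add: y(2) char2)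
  finally show "\<exists>t. \<sigma> (\<sigma> t) * \<sigma> t * t + a * (\<sigma> (\<sigma> t) * \<sigma> t) + 1 = 0" by blast
next
  fix t assume t: "\<sigma> (\<sigma> t) * \<sigma> t * t + a * (\<sigma> (\<sigma> t) * \<sigma> t) + 1 = 0"
  then have "t \<noteq> 0" by (auto simp: \<sigma>_zero)
  then obtain y where y: "y \<noteq> 0" "\<sigma> y = inverse t * y" using \<sigma>_scaling[of "inverse t"] by auto
  have ty: "t = y / \<sigma> y" using y \<open>t \<noteq> 0\<close> by (simp add: field_simps \<sigma>_eq_0)
  have "0 = \<sigma> (\<sigma> (\<sigma> y)) * (\<sigma> (\<sigma> t) * \<sigma> t * t + a * (\<sigma> (\<sigma> t) * \<sigma> t) + 1)" using t by simp
  also have "\<dots> = y + (\<sigma> (\<sigma> (\<sigma> y)) + a * \<sigma> y)"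
    unfolding ty using y(1) by (simp add: \<sigma>_divide \<sigma>_eq_0 field_simps)
  finally have "\<sigma> (\<sigma> (\<sigma> y)) + a * \<sigma> y = y" by (metis add_eq_0)
  then have "fixed_vector a (\<sigma> (\<sigma> y)) y (\<sigma> y)" using y by (simp add: fixed_vector_def)
  then show "\<exists>x y z. fixed_vector a x y z" by blast
qed

end

section \<open>Frobenius powers on F_(2^m)\<close>

lemma finite_field_power_card:
  fixes x :: "'a::{field,finite}"
  shows "x ^ CARD('a) = x"
proof (cases "x = 0")
  case False
  let ?U = "UNIV - {0::'a}"
  have "prod (\<lambda>y. x * y) ?U = prod id ?U"
    by (rule prod.reindex_bij_witness[of _ "\<lambda>y. y / x" "\<lambda>y. x * y"]) (use False in auto)
  then have "x ^ card ?U * prod id ?U = prod id ?U" by (simp add: prod.distrib)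
  moreover have "prod id ?U \<noteq> 0" by simp
  ultimately have "x ^ card ?U = 1" by simp
  moreover have "CARD('a) = Suc (card ?U)"
    by (simp add: card_Suc_Diff1)
  ultimately show ?thesis by (metis power_Suc mult_1_right)
qed (simp add: power_0_left)

lemma power_power_iterate:
  fixes x :: "'a::monoid_mult"
  assumes "x ^ k = x"
  shows "x ^ (k ^ n) = x"
  by (induction n) (simp_all add: power_mult assms)

lemma CHAR_eq_2:
  assumes "CARD('a::{field,finite}) = 2 ^ m"
  shows "CHAR('a) = 2"
proof -
  have pos: "CHAR('a) > 0" by (simp add: finite_imp_CHAR_pos)
  then have p: "prime CHAR('a)" by (rule prime_CHAR_semidom)
  have "CHAR('a) dvd 2 ^ m" using CHAR_dvd_CARD[where 'a = 'a] assms by simp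
  with p have "CHAR('a) dvd 2" by (rule prime_dvd_power)
  with p show ?thesis by (simp add: primes_dvd_imp_eq)
qed

lemma char2_frobenius_power:
  assumes card: "CARD('a::{field,finite}) = 2 ^ m" and "coprime i m" and "m \<noteq> 1"
  shows "char2_frobenius (\<lambda>x::'a. x ^ 2 ^ i)"
proof
  note char = CHAR_eq_2[OF card]
  fix x y :: 'a
  have "(2::'a) = 0" using of_nat_CHAR[where 'a = 'a] char by simp
  then show "x + x = 0" by (metis mult_2 mult_zero_left)
  show "(x + y) ^ 2 ^ i = x ^ 2 ^ i + y ^ 2 ^ i"
    by (rule freshmans_dream') (simp_all add: char)
  show "(x * y) ^ 2 ^ i = x ^ 2 ^ i * y ^ 2 ^ i" by (rule power_mult_distrib)
  show "(1::'a) ^ 2 ^ i = 1" by simp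
  show "x = 0 \<or> x = 1" if fixed: "x ^ 2 ^ i = x"
  proof -
    \<comment> \<open>Exponents modulo \<open>m\<close> reduce the fixed-point equation to
      \<open>x = x ^ 2\<close>. The condition \<open>m \<noteq> 1\<close> excludes
      \<open>i = 0\<close>, \<open>m = 1\<close>, where no natural \<open>c\<close>,
      \<open>d\<close> exist.\<close>
    obtain c d where cd: "i * c = m * d + 1"
      using coprime_bezout_strong[OF assms(2,3)] by blast
    have "x = x ^ 2 ^ (i * c)" using power_power_iterate[OF fixed, of c] by (simp add: power_mult)
    also have "\<dots> = (x ^ (2 ^ m) ^ d) ^ 2"
      unfolding cd by (simp add: power_add mult.commute flip: power_mult)
    also have "\<dots> = x ^ 2"
      using power_power_iterate[OF finite_field_power_card[of x], of d] by (simp add: card)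
    finally have "x * (x - 1) = 0" by (simp add: power2_eq_square algebra_simps)
    then show ?thesis by auto
  qed
qed

section \<open>APN criterion for quadratic maps\<close>

text \<open>Additivity of the polar form puts the difference of two solutions for the same
  \<open>u\<close> and \<open>b\<close> into its kernel, which always contains 0 and
  \<open>u\<close>.\<close>

lemma APN_iff_polar_kernel:
  fixes F :: "'a::{field,finite} ^ 'n \<Rightarrow> 'a ^ 'n"
  assumes char2: "\<And>x::'a. x + x = 0" and "F 0 = 0"
    and polar_add: "\<And>u x y. F (x + y + u) + F (x + y) + F u
      = (F (x + u) + F x + F u) + (F (y + u) + F y + F u)"
  shows "APN F \<longleftrightarrow> (\<forall>u v. u \<noteq> 0 \<longrightarrow> F (v + u) + F v + F u = 0 \<longrightarrow> v = 0 \<or> v = u)"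
proof -
  have vec2: "w + w = 0" for w :: "'a ^ 'n" by (simp only: vec_eq_iff vector_add_component zero_index char2 simp_thms)
  have vec_eq: "v + w = 0 \<longleftrightarrow> v = w" for v w :: "'a ^ 'n"
    using vec2[of w] by (metis add_right_cancel)
  show ?thesis
  proof (intro iffI allI impI)
    fix u v assume "APN F" and u: "u \<noteq> 0" and uv: "F (v + u) + F v + F u = 0"
    show "v = 0 \<or> v = u"
    proof (rule ccontr)
      assume v: "\<not> (v = 0 \<or> v = u)"
      \<comment> \<open>For \<open>b = F u\<close> the solutions are exactly the kernel elements, so
        0, \<open>u\<close>, \<open>v\<close> would be three of them.\<close>
      have "F (v + u) + F v = F u" using uv by (simp only: vec_eq)
      then have "{0, u, v} \<subseteq> {x. F (x + u) + F x = F u}"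
        using \<open>F 0 = 0\<close> by (simp add: vec2)
      then have "card {0, u, v} \<le> card {x. F (x + u) + F x = F u}" by (intro card_mono) auto
      moreover have "card {0, u, v} = 3" using u v by auto
      moreover have "card {x. F (x + u) + F x = F u} \<le> 2"
        using \<open>APN F\<close> u unfolding APN_def by blast
      ultimately show False by linarith
    qed
  next
    assume ker: "\<forall>u v. u \<noteq> 0 \<longrightarrow> F (v + u) + F v + F u = 0 \<longrightarrow> v = 0 \<or> v = u"
    show "APN F" unfolding APN_def
    proof (intro allI impI)
      fix u b :: "'a ^ 'n" assume u: "u \<noteq> 0"
      let ?S = "{x. F (x + u) + F x = b}"
      show "card ?S \<le> 2"
      proof (cases "?S = {}")
        case False
        then obtain w where w: "F (w + u) + F w = b" by blast
        have "?S \<subseteq> {w, w + u}"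
        proof
          fix x assume "x \<in> ?S"
          then have "F (x + w + u) + F (x + w) + F u = (b + F u) + (b + F u)"
            unfolding polar_add w by simp
          then have "F (x + w + u) + F (x + w) + F u = 0" unfolding vec2 .
          with ker u have "x + w = 0 \<or> x + w = u" by blast
          moreover have "x + w + w = x" by (simp only: add.assoc vec2 add_0_right)
          ultimately have "x = w \<or> x = u + w" unfolding vec_eq by metis
          then show "x \<in> {w, w + u}" by (simp add: add.commute)
        qed
        then have "card ?S \<le> card {w, w + u}" by (intro card_mono) auto
        also have "\<dots> \<le> 2" by (simp add: card_insert_if)
        finally show ?thesis .
      qed simp
    qed
  qed
qed

section \<open>\<open>H\<close> as a cross product and its polar form\<close>

context char2_frobenius
begin

text \<open>The coordinates of v x \<open>\<phi>\<close> v in reverse order; signs vanish in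
  characteristic 2.\<close>

definition quad :: "'a \<Rightarrow> 'a ^ 3 \<Rightarrow> 'a ^ 3" where
  "quad a v = (let x = v $ 1; y = v $ 2; z = v $ 3 in
     vector [x * (\<sigma> x + a * \<sigma> y) + y * \<sigma> z,
             x * \<sigma> y + z * \<sigma> z,
             y * \<sigma> y + z * (\<sigma> x + a * \<sigma> y)])"

text \<open>The sum u x \<open>\<phi>\<close> v + v x \<open>\<phi>\<close> u, in the same
  coordinate order.\<close>

definition polar :: "'a \<Rightarrow> 'a ^ 3 \<Rightarrow> 'a ^ 3 \<Rightarrow> 'a ^ 3" where
  "polar a u v = (let x = u $ 1; y = u $ 2; z = u $ 3; X = v $ 1; Y = v $ 2; Z = v $ 3 in
     vector [x * (\<sigma> X + a * \<sigma> Y) + y * \<sigma> Z + (X * (\<sigma> x + a * \<sigma> y) + Y * \<sigma> z),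
             x * \<sigma> Y + z * \<sigma> Z + (X * \<sigma> y + Z * \<sigma> z),
             y * \<sigma> Y + z * (\<sigma> X + a * \<sigma> Y) + (Y * \<sigma> y + Z * (\<sigma> x + a * \<sigma> y))])"

lemma add_add_cancel: "x + (x + y) = (y::'a)"
  by (simp add: char2 flip: add.assoc)

lemma quad_polar: "quad a (v + u) + quad a v + quad a u = polar a u v"
  by (simp add: vec_eq_iff forall_3 quad_def polar_def Let_def \<sigma>_add algebra_simps
      char2 add_add_cancel)

lemma polar_add: "polar a u (v + w) = polar a u v + polar a u w"
  by (simp add: vec_eq_iff forall_3 polar_def Let_def \<sigma>_add algebra_simps)

lemma APN_quad_iff: "APN (quad a) \<longleftrightarrow> (\<forall>u v. u \<noteq> 0 \<longrightarrow> polar a u v = 0 \<longrightarrow> v = 0 \<or> v = u)"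
proof -
  have "quad a 0 = 0" by (simp add: vec_eq_iff forall_3 quad_def Let_def)
  then show ?thesis
    by (subst APN_iff_polar_kernel) (simp_all only: char2 quad_polar polar_add)
qed

text \<open>If \<open>\<phi>\<close> u = u and v = l u, both terms of the polar form are multiples
  of u x u = 0.\<close>

lemma fixed_vector_imp_not_APN:
  fixes l :: 'a
  assumes "fixed_vector a x y z" and "l \<noteq> 0" "l \<noteq> 1"
  shows "\<not> APN (quad a)"
proof -
  let ?u = "vector [x, y, z] :: 'a ^ 3" and ?v = "vector [l * x, l * y, l * z] :: 'a ^ 3"
  have fv: "(x, y, z) \<noteq> (0, 0, 0)" "\<sigma> z = x" "\<sigma> x + a * \<sigma> y = y" "\<sigma> y = z"
    using assms by (auto simp: fixed_vector_def)
  have "\<sigma> (l * x) + a * \<sigma> (l * y) = \<sigma> l * (\<sigma> x + a * \<sigma> y)"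
    by (simp add: \<sigma>_mult algebra_simps)
  then have lv: "\<sigma> (l * x) + a * \<sigma> (l * y) = \<sigma> l * y" unfolding fv(3) .
  have "polar a ?u ?v = 0"
    unfolding polar_def Let_def vector_3 unfolding lv fv(3)
    unfolding \<sigma>_mult fv(2,4)
    by (simp only: vec_eq_iff forall_3 vector_3 zero_index mult_ac char2 add_0_left simp_thms)
  moreover have "?u \<noteq> 0" "?v \<noteq> 0" "?v \<noteq> ?u"
    using fv(1) assms(2,3) by (auto simp: vec_eq_iff forall_3)
  ultimately show ?thesis unfolding APN_quad_iff by blast
qed

lemma not_APN_imp_fixed_vector:
  assumes "\<not> APN (quad a)"
  shows "\<exists>x y z. fixed_vector a x y z"
proof -
  obtain u v where "u \<noteq> 0" and p: "polar a u v = 0" and "v \<noteq> 0" "v \<noteq> u"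
    using assms unfolding APN_quad_iff by blast
  define x y z X Y Z where coords: "x = u $ 1" "y = u $ 2" "z = u $ 3" "X = v $ 1" "Y = v $ 2" "Z = v $ 3"
  have u: "(x, y, z) \<noteq> (0, 0, 0)" using \<open>u \<noteq> 0\<close> by (auto simp: vec_eq_iff forall_3 coords)
  have v: "(X, Y, Z) \<noteq> (0, 0, 0)" using \<open>v \<noteq> 0\<close> by (auto simp: vec_eq_iff forall_3 coords)
  have vu: "(X, Y, Z) \<noteq> (x, y, z)" using \<open>v \<noteq> u\<close> by (auto simp: vec_eq_iff forall_3 coords)
  have c: "x * (\<sigma> X + a * \<sigma> Y) + y * \<sigma> Z = X * (\<sigma> x + a * \<sigma> y) + Y * \<sigma> z"
    "x * \<sigma> Y + z * \<sigma> Z = X * \<sigma> y + Z * \<sigma> z"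
    "y * \<sigma> Y + z * (\<sigma> X + a * \<sigma> Y) = Y * \<sigma> y + Z * (\<sigma> x + a * \<sigma> y)"
    using p by (simp_all add: vec_eq_iff forall_3 polar_def Let_def coords[symmetric] add_eq_0)
  show ?thesis
  \<comment> \<open>A nonzero u x v means that u and v span an invariant plane; otherwise v is a
    multiple of u.\<close>
  proof (cases "(y * Z - z * Y, z * X - x * Z, x * Y - y * X) = (0, 0, 0)")
    case False
    then show ?thesis
      by (rule invariant_plane_imp_fixed_vector) (use c in \<open>simp_all only: minus_eq_add\<close>)
  next
    case True
    then have "x * Y = y * X" "x * Z = z * X" "y * Z = z * Y" by auto
    then obtain l where l: "X = l * x" "Y = l * y" "Z = l * z"
      by (rule parallel_coords[OF u])
    have "l \<noteq> 0" "l \<noteq> 1" using l v vu by auto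
    then have "\<sigma> l \<noteq> l" using \<sigma>_fixed by blast
    then have l': "\<sigma> l + l \<noteq> 0" by (simp add: add_eq_0)
    \<comment> \<open>For v = l u the polar form is \<open>\<sigma> l + l\<close> times u x
      \<open>\<phi>\<close> u, and this factor is nonzero for \<open>l\<close> outside F_2.\<close>
    have "(\<sigma> l + l) * (x * (\<sigma> x + a * \<sigma> y) + y * \<sigma> z) =
        x * (\<sigma> X + a * \<sigma> Y) + y * \<sigma> Z + (X * (\<sigma> x + a * \<sigma> y) + Y * \<sigma> z)"
      "(\<sigma> l + l) * (x * \<sigma> y + z * \<sigma> z) =
        x * \<sigma> Y + z * \<sigma> Z + (X * \<sigma> y + Z * \<sigma> z)"
      "(\<sigma> l + l) * (y * \<sigma> y + z * (\<sigma> x + a * \<sigma> y)) =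
        y * \<sigma> Y + z * (\<sigma> X + a * \<sigma> Y) + (Y * \<sigma> y + Z * (\<sigma> x + a * \<sigma> y))"
      unfolding l \<sigma>_mult by (simp_all add: algebra_simps)
    then have "x * (\<sigma> x + a * \<sigma> y) + y * \<sigma> z = 0" "x * \<sigma> y + z * \<sigma> z = 0"
      "y * \<sigma> y + z * (\<sigma> x + a * \<sigma> y) = 0"
      unfolding c char2 mult_eq_0_iff using l' by blast+
    then have "x * (\<sigma> x + a * \<sigma> y) = y * \<sigma> z" "x * \<sigma> y = z * \<sigma> z"
      "y * \<sigma> y = z * (\<sigma> x + a * \<sigma> y)"
      unfolding add_eq_0 .
    then show ?thesis by (rule cross_eq_0_imp_fixed_vector[OF u])
  qed
qed

end

theorem theorem3p2:
  fixes a :: "'a::{field,finite}" and m i q :: nat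
  assumes "m \<ge> 3" and "odd m" and "CARD('a) = 2 ^ m"
    and "gcd i m = 1" and "q = 2 ^ i"
    and "a \<noteq> 0"
  shows "APN (H q a) \<longleftrightarrow> (\<nexists>t. poly (P' q a) t = 0)"
proof -
  interpret char2_frobenius "\<lambda>x::'a. x ^ q"
    unfolding \<open>q = 2 ^ i\<close>
    by (rule char2_frobenius_power) (use assms in \<open>auto simp: coprime_iff_gcd_eq_1\<close>)
  have "H q a = quad a"
    by (simp add: fun_eq_iff vec_eq_iff forall_3 H_def quad_def Let_def algebra_simps)
  \<comment> \<open>At least eight elements guarantee a scalar outside F_2, as the second kernel
    vector \<open>l\<close> u requires.\<close>
  have "(2::nat) ^ 3 \<le> 2 ^ m" using \<open>m \<ge> 3\<close> by (rule power_increasing) simp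
  then have "\<not> (UNIV :: 'a set) \<subseteq> {0, 1}"
    using card_mono[of "{0, 1::'a}" UNIV] \<open>CARD('a) = 2 ^ m\<close> by (auto simp: card_insert_if)
  then obtain l :: 'a where "l \<noteq> 0" "l \<noteq> 1" by auto
  then have "APN (H q a) \<longleftrightarrow> (\<nexists>x y z. fixed_vector a x y z)"
    unfolding \<open>H q a = quad a\<close>
    using fixed_vector_imp_not_APN not_APN_imp_fixed_vector by blast
  also have "\<dots> \<longleftrightarrow> (\<nexists>t. poly (P' q a) t = 0)"
    unfolding fixed_vector_iff_root P'_def
    by (simp add: poly_monom power_add power2_eq_square algebra_simps flip: power_mult)
  finally show ?thesis .
qed

end
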